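(* The class of all IP loops has the Finite Embedding Property: for every IP loop $(G,\cdot)$ and every nonempty finite subset $X\subseteq G$ there exists a finite IP loop $(H,* )$ with $X\subseteq H$ such that $x\cdot y = x*y$ for all $x,y\in X$ with $x\cdot y\in X$.
   Context: An IP loop (loop with the inverse property) is a loop in which every element $x$ has a two-sided inverse $x^{-1}$ and the identities $x^{-1}(xy)=y=(yx)x^{-1}$ hold. *)

theory Defs
  imports Main
begin

definition loop :: "'a set \<Rightarrow> ('a \<Rightarrow> 'a \<Rightarrow> 'a) \<Rightarrow> bool" where
  "loop G m \<longleftrightarrow>
     (\<forall>x\<in>G. \<forall>y\<in>G. m x y \<in> G) \<and>
     (\<exists>e\<in>G. \<forall>x\<in>G. m e x = x \<and> m x e = x) \<and>
     (\<forall>a\<in>G. \<forall>b\<in>G. \<exists>!x. x \<in> G \<and> m a x = b) \<and>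
     (\<forall>a\<in>G. \<forall>b\<in>G. \<exists>!y. y \<in> G \<and> m y a = b)"

definition ip_loop :: "'a set \<Rightarrow> ('a \<Rightarrow> 'a \<Rightarrow> 'a) \<Rightarrow> bool" where
  "ip_loop G m \<longleftrightarrow> loop G m \<and>
     (\<exists>e\<in>G. (\<forall>x\<in>G. m e x = x \<and> m x e = x) \<and>
        (\<forall>x\<in>G. \<exists>x'\<in>G. m x x' = e \<and> m x' x = e \<and>
            (\<forall>y\<in>G. m x' (m x y) = y \<and> m (m y x) x' = y)))"

end

theory Submission
  imports Defs "HOL-Library.Function_Algebras" "HOL-Library.Numeral_Type"
begin

text \<open>
  Write an IP loop as the set of triples \<open>(a, b, c)\<close> with \<open>abc = 1\<close>; this set is closed under rotation
  and under \<open>(a, b, c) \<mapsto> (c\<inverse>, b\<inverse>, a\<inverse>)\<close>, and any two entries determine the third. Let \<open>Y\<close> be the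
  nontrivial part of \<open>X \<union> X\<inverse>\<close> and let \<open>P\<close> be the set of triples of \<open>Y\<close> with product 1.

  First all elements of \<open>Y\<close> are placed in a finite IP loop in which the products \<open>xy = v(x, y)\<inverse>\<close>, with
  \<open>(x, y, z) \<in> P\<close>, are in general position except that \<open>v(x, y) v(y, z) v(z, x) = 1\<close>. In that loop the
  triples \<open>(x, y, v(x, y))\<close>, \<open>(y, z, v(y, z))\<close>, \<open>(z, x, v(z, x))\<close>, \<open>(v(x, y), v(y, z), v(z, x))\<close> are four
  alternate faces of an octahedron, and they are replaced by the other four faces, one of which is
  \<open>(x, y, z)\<close>. The opposite faces use the same pairs of adjacent entries, so the result is again an IP
  loop, and different triples of \<open>P\<close> do not interfere.
\<close>

section \<open>IP loops as systems of triples\<close>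

text \<open>Cancelling by \<open>i a\<close> makes the solution of \<open>m a x = b\<close> unique;
  as \<open>i\<close> is an involution, the same law for \<open>i a\<close> shows that
  \<open>m (i a) b\<close> is a solution.\<close>

lemma ip_loopI:
  assumes e: "e \<in> H" and i: "\<And>a. a \<in> H \<Longrightarrow> i a \<in> H"
    and m: "\<And>a b. a \<in> H \<Longrightarrow> b \<in> H \<Longrightarrow> m a b \<in> H"
    and unit: "\<And>a. a \<in> H \<Longrightarrow> m e a = a" "\<And>a. a \<in> H \<Longrightarrow> m a e = a"
    and inverse: "\<And>a. a \<in> H \<Longrightarrow> m a (i a) = e" "\<And>a. a \<in> H \<Longrightarrow> m (i a) a = e"
    and cancel: "\<And>a b. a \<in> H \<Longrightarrow> b \<in> H \<Longrightarrow> m (i a) (m a b) = b"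
      "\<And>a b. a \<in> H \<Longrightarrow> b \<in> H \<Longrightarrow> m (m b a) (i a) = b"
  shows "ip_loop H m"
proof -
  have i_i: "i (i a) = a" if "a \<in> H" for a
    using cancel(1)[OF i[OF that] that] inverse(2)[OF that] unit(2)[OF i[OF i[OF that]]] by simp
  have "\<exists>!x. x \<in> H \<and> m a x = b" if "a \<in> H" "b \<in> H" for a b
  proof (rule ex1I[of _ "m (i a) b"])
    show "m (i a) b \<in> H \<and> m a (m (i a) b) = b"
      using cancel(1)[OF i[OF that(1)] that(2)] i_i[OF that(1)] m[OF i[OF that(1)] that(2)] by simp
  qed (use cancel(1)[OF that(1)] in auto)
  moreover have "\<exists>!x. x \<in> H \<and> m x a = b" if "a \<in> H" "b \<in> H" for a b
  proof (rule ex1I[of _ "m b (i a)"])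
    show "m b (i a) \<in> H \<and> m (m b (i a)) a = b"
      using cancel(2)[OF i[OF that(1)] that(2)] i_i[OF that(1)] m[OF that(2) i[OF that(1)]] by simp
  qed (use cancel(2)[OF that(1)] in auto)
  ultimately have "loop H m"
    unfolding loop_def using m by (intro conjI ballI bexI[OF _ e]) (simp_all add: unit)
  moreover have "\<forall>x\<in>H. \<exists>x'\<in>H. m x x' = e \<and> m x' x = e \<and> (\<forall>y\<in>H. m x' (m x y) = y \<and> m (m y x) x' = y)"
    by (intro ballI bexI[OF _ i] conjI) (simp_all add: inverse cancel)
  ultimately show ?thesis
    unfolding ip_loop_def using e unit by (intro conjI bexI[OF _ e]) simp_all
qed

lemma ip_loopE:
  assumes "ip_loop H m"
  obtains e i where "e \<in> H" "\<And>a. a \<in> H \<Longrightarrow> i a \<in> H"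
    "\<And>a b. a \<in> H \<Longrightarrow> b \<in> H \<Longrightarrow> m a b \<in> H"
    "\<And>a. a \<in> H \<Longrightarrow> m e a = a" "\<And>a. a \<in> H \<Longrightarrow> m a e = a"
    "\<And>a. a \<in> H \<Longrightarrow> m a (i a) = e" "\<And>a. a \<in> H \<Longrightarrow> m (i a) a = e"
    "\<And>a b. a \<in> H \<Longrightarrow> b \<in> H \<Longrightarrow> m (i a) (m a b) = b"
    "\<And>a b. a \<in> H \<Longrightarrow> b \<in> H \<Longrightarrow> m (m b a) (i a) = b"
    "\<And>a. a \<in> H \<Longrightarrow> i (i a) = a"
proof -
  have closed: "\<forall>a\<in>H. \<forall>b\<in>H. m a b \<in> H"
    using assms by (simp add: ip_loop_def loop_def)
  obtain e where e: "e \<in> H" "\<forall>a\<in>H. m e a = a \<and> m a e = a"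
    and "\<forall>a\<in>H. \<exists>a'. a' \<in> H \<and> m a a' = e \<and> m a' a = e \<and>
      (\<forall>b\<in>H. m a' (m a b) = b \<and> m (m b a) a' = b)"
    using assms unfolding ip_loop_def Bex_def by blast
  from bchoice[OF this(3)] obtain i where i: "\<forall>a\<in>H. i a \<in> H \<and> m a (i a) = e \<and> m (i a) a = e \<and>
      (\<forall>b\<in>H. m (i a) (m a b) = b \<and> m (m b a) (i a) = b)"
    by blast
  have "i (i a) = a" if "a \<in> H" for a
  proof -
    have "m (i (i a)) (m (i a) a) = a"
      using that i by blast
    then show ?thesis
      using that i e by simp
  qed
  then show thesis
    using that[of e i] closed e i by blast
qed

text \<open>\<open>T a b c\<close> stands for abc = e, and \<open>T_flip\<close> for inverting this
  product. Rotation carries existence and uniqueness of the third entry over to the other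
  two.\<close>

locale ip_system =
  fixes H :: "'b set" and e :: 'b and i :: "'b \<Rightarrow> 'b" and T :: "'b \<Rightarrow> 'b \<Rightarrow> 'b \<Rightarrow> bool"
  assumes e_in: "e \<in> H" and i_e: "i e = e"
    and i_in: "a \<in> H \<Longrightarrow> i a \<in> H" and i_i: "a \<in> H \<Longrightarrow> i (i a) = a"
    and T_in: "T a b c \<Longrightarrow> a \<in> H \<and> b \<in> H \<and> c \<in> H"
    and T_rot: "T a b c \<Longrightarrow> T b c a"
    and T_flip: "T a b c \<Longrightarrow> T (i c) (i b) (i a)"
    and T_ex: "a \<in> H \<Longrightarrow> b \<in> H \<Longrightarrow> \<exists>c. T a b c"
    and T_unique: "T a b c \<Longrightarrow> T a b d \<Longrightarrow> c = d"
    and T_unit: "a \<in> H \<Longrightarrow> T e a (i a)"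
begin

definition mul :: "'b \<Rightarrow> 'b \<Rightarrow> 'b" where
  "mul a b = i (THE c. T a b c)"

lemma mul_eq: "T a b c \<Longrightarrow> mul a b = i c"
  unfolding mul_def using T_unique by (metis the_equality)

lemma mul_unit_left: "a \<in> H \<Longrightarrow> mul e a = a"
  using mul_eq[OF T_unit] i_i by simp

lemma mul_unit_right: "a \<in> H \<Longrightarrow> mul a e = a"
  using mul_eq[OF T_rot[OF T_rot[OF T_unit[OF i_in]]]] i_i by simp

lemma mul_i_right: "a \<in> H \<Longrightarrow> mul a (i a) = e"
  using mul_eq[OF T_rot[OF T_unit]] i_e by simp

lemma mul_i_left: "a \<in> H \<Longrightarrow> mul (i a) a = e"
  using mul_i_right[OF i_in] i_i by simp

lemma mul_in: "a \<in> H \<Longrightarrow> b \<in> H \<Longrightarrow> mul a b \<in> H"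
  using T_ex mul_eq T_in i_in by metis

text \<open>From \<open>T a b c\<close>, flipping and rotating give
  \<open>T (i a) (i c) (i b)\<close>; as ab is \<open>i c\<close>, this reads a^-1 (ab) = b.\<close>

lemma mul_cancel_left: "a \<in> H \<Longrightarrow> b \<in> H \<Longrightarrow> mul (i a) (mul a b) = b"
  using T_ex mul_eq T_in i_i T_flip T_rot by metis

lemma mul_cancel_right: "a \<in> H \<Longrightarrow> b \<in> H \<Longrightarrow> mul (mul b a) (i a) = b"
  using T_ex mul_eq T_in i_i T_flip T_rot by metis

lemma ip_loop_mul: "ip_loop H mul"
  by (rule ip_loopI[of e H i]) (simp_all add: e_in i_in mul_in mul_unit_left mul_unit_right
      mul_i_left mul_i_right mul_cancel_left mul_cancel_right)

text \<open>A pair of adjacent entries met by \<open>W\<close> loses its only triple of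
  \<open>T\<close> and gains exactly one from \<open>B\<close>; all other pairs keep theirs. The
  unit triples survive because \<open>W\<close> avoids \<open>e\<close>.\<close>

lemma trade:
  assumes W_T: "\<And>a b c. W a b c \<Longrightarrow> T a b c"
    and W_rot: "\<And>a b c. W a b c \<Longrightarrow> W b c a"
    and W_flip: "\<And>a b c. W a b c \<Longrightarrow> W (i c) (i b) (i a)"
    and W_unit: "\<And>a b. \<not> W e a b"
    and B_in: "\<And>a b c. B a b c \<Longrightarrow> a \<in> H"
    and B_rot: "\<And>a b c. B a b c \<Longrightarrow> B b c a"
    and B_flip: "\<And>a b c. B a b c \<Longrightarrow> B (i c) (i b) (i a)"
    and B_unique: "\<And>a b c d. B a b c \<Longrightarrow> B a b d \<Longrightarrow> c = d"
    and pairs: "\<And>a b. (\<exists>c. W a b c) \<longleftrightarrow> (\<exists>c. B a b c)"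
  shows "ip_system H e i (\<lambda>a b c. T a b c \<and> \<not> W a b c \<or> B a b c)"
proof
  have W_flip': "W a b c" if "W (i c) (i b) (i a)" "T a b c" for a b c
    using W_flip[OF that(1)] T_in[OF that(2)] i_i by simp
  show "T (i c) (i b) (i a) \<and> \<not> W (i c) (i b) (i a) \<or> B (i c) (i b) (i a)"
    if "T a b c \<and> \<not> W a b c \<or> B a b c" for a b c
    using that T_flip B_flip W_flip' by blast
  show "T b c a \<and> \<not> W b c a \<or> B b c a" if "T a b c \<and> \<not> W a b c \<or> B a b c" for a b c
    using that T_rot B_rot W_rot by blast
  show "\<exists>c. T a b c \<and> \<not> W a b c \<or> B a b c" if "a \<in> H" "b \<in> H" for a b
    using T_ex[OF that] pairs by blast
  show "c = d" if "T a b c \<and> \<not> W a b c \<or> B a b c" "T a b d \<and> \<not> W a b d \<or> B a b d" for a b c d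
    using that pairs W_T T_unique B_unique by metis
  show "a \<in> H \<and> b \<in> H \<and> c \<in> H" if "T a b c \<and> \<not> W a b c \<or> B a b c" for a b c
    using that T_in B_in B_rot by blast
qed (use e_in i_e i_in i_i T_unit W_unit in auto)

end

section \<open>A loop with prescribed products of odd elements\<close>

definition subgroup :: "'g::ab_group_add set \<Rightarrow> bool" where
  "subgroup A \<longleftrightarrow> 0 \<in> A \<and> (\<forall>a\<in>A. \<forall>b\<in>A. a - b \<in> A)"

lemma subgroup_closed:
  assumes "subgroup A"
  shows "0 \<in> A" "a \<in> A \<Longrightarrow> b \<in> A \<Longrightarrow> a - b \<in> A" "a \<in> A \<Longrightarrow> - a \<in> A"
    "a \<in> A \<Longrightarrow> b \<in> A \<Longrightarrow> a + b \<in> A"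
proof -
  show 0: "0 \<in> A" and diff: "a \<in> A \<Longrightarrow> b \<in> A \<Longrightarrow> a - b \<in> A" for a b
    using assms unfolding subgroup_def by auto
  show neg: "a \<in> A \<Longrightarrow> - a \<in> A" for a
    using diff[OF 0] by simp
  show "a \<in> A \<Longrightarrow> b \<in> A \<Longrightarrow> a + b \<in> A"
    using diff[OF _ neg] by simp
qed

text \<open>
  Elements \<open>(p, a, u)\<close> are even or odd according to the Boolean \<open>p\<close>. Even elements multiply as in the
  group \<open>A \<times> U\<close>; the product of two odd elements is even, with \<open>g\<close> twisting its \<open>U\<close>-coordinate and \<open>\<tau>\<close>
  its \<open>A\<close>-coordinate. Since \<open>g\<close> and \<open>\<tau>\<close> are arbitrary odd functions, the product of two given odd
  elements can be prescribed.
\<close>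

locale two_part_system =
  fixes A :: "'g::ab_group_add set" and U :: "'h::ab_group_add set"
    and g :: "'g \<Rightarrow> 'g \<Rightarrow> 'h" and \<tau> :: "'h \<Rightarrow> 'g"
  assumes A: "subgroup A" and U: "subgroup U"
    and g_in: "g a b \<in> U" and \<tau>_in: "\<tau> u \<in> A"
    and g_odd: "g (- b) (- a) = - g a b" and g_inverse: "g a (- a) = 0"
    and \<tau>_odd: "\<tau> (- u) = - \<tau> u" and \<tau>_0: "\<tau> 0 = 0"
begin

definition carrier :: "(bool \<times> 'g \<times> 'h) set" where
  "carrier = UNIV \<times> A \<times> U"

fun inv :: "bool \<times> 'g \<times> 'h \<Rightarrow> bool \<times> 'g \<times> 'h" where
  "inv (p, a, u) = (p, - a, - u)"

text \<open>\<open>\<tau>\<close> reads only the even entry's second coordinate and \<open>g\<close>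
  only the odd entries' first ones, so any missing entry can be solved for one coordinate at a
  time.\<close>

definition mixed :: "'g \<Rightarrow> 'h \<Rightarrow> 'g \<Rightarrow> 'h \<Rightarrow> 'g \<Rightarrow> 'h \<Rightarrow> bool" where
  "mixed a u b v c w \<longleftrightarrow> a + b + c = \<tau> w \<and> u + v + w = g a b"

fun rel :: "bool \<times> 'g \<times> 'h \<Rightarrow> bool \<times> 'g \<times> 'h \<Rightarrow> bool \<times> 'g \<times> 'h \<Rightarrow> bool" where
  "rel (False, a, u) (False, b, v) (False, c, w) \<longleftrightarrow> a + b + c = 0 \<and> u + v + w = 0"
| "rel (True, a, u) (True, b, v) (False, c, w) \<longleftrightarrow> mixed a u b v c w"
| "rel (False, a, u) (True, b, v) (True, c, w) \<longleftrightarrow> mixed b v c w a u"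
| "rel (True, a, u) (False, b, v) (True, c, w) \<longleftrightarrow> mixed c w a u b v"
| "rel _ _ _ \<longleftrightarrow> False"

lemma mixed_flip:
  assumes "mixed a u b v c w"
  shows "mixed (- b) (- v) (- a) (- u) (- c) (- w)"
proof -
  have "- b + - a + - c = - (a + b + c)" "- v + - u + - w = - (u + v + w)"
    by (simp_all add: algebra_simps)
  moreover have "a + b + c = \<tau> w" "u + v + w = g a b"
    using assms by (simp_all only: mixed_def)
  ultimately show ?thesis
    by (simp only: mixed_def g_odd \<tau>_odd)
qed

sublocale ip_system carrier "(False, 0, 0)" inv
  "\<lambda>a b c. a \<in> carrier \<and> b \<in> carrier \<and> c \<in> carrier \<and> rel a b c"
proof
  note closed = subgroup_closed[OF A] subgroup_closed[OF U]
  show "(False, 0, 0) \<in> carrier" "inv (False, 0, 0) = (False, 0, 0)"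
    by (auto simp: carrier_def closed)
  show inv_in: "inv a \<in> carrier" if "a \<in> carrier" for a
    using that by (cases a) (auto simp: carrier_def closed)
  show "inv (inv a) = a" for a
    by (cases a) auto
  show "b \<in> carrier \<and> c \<in> carrier \<and> a \<in> carrier \<and> rel b c a"
    if "a \<in> carrier \<and> b \<in> carrier \<and> c \<in> carrier \<and> rel a b c" for a b c
    using that by (cases "(a, b, c)" rule: rel.cases) (auto simp: algebra_simps)
  show "inv c \<in> carrier \<and> inv b \<in> carrier \<and> inv a \<in> carrier \<and> rel (inv c) (inv b) (inv a)"
    if "a \<in> carrier \<and> b \<in> carrier \<and> c \<in> carrier \<and> rel a b c" for a b c
  proof -
    have "rel (inv c) (inv b) (inv a)"
      using that by (cases "(a, b, c)" rule: rel.cases)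
        (auto simp: mixed_flip algebra_simps intro!: minus_unique)
    then show ?thesis
      using that inv_in by blast
  qed
  show "(False, 0, 0) \<in> carrier \<and> a \<in> carrier \<and> inv a \<in> carrier \<and> rel (False, 0, 0) a (inv a)"
    if "a \<in> carrier" for a
  proof (cases a)
    case (fields p b u)
    \<comment> \<open>For an odd element this asks for \<open>g b (- b) = 0\<close> and
      \<open>\<tau> 0 = 0\<close>.\<close>
    then show ?thesis
      using that inv_in[OF that]
      by (cases p) (auto simp: carrier_def mixed_def g_inverse \<tau>_0 closed)
  qed
  show "c = d" if "a \<in> carrier \<and> b \<in> carrier \<and> c \<in> carrier \<and> rel a b c"
    "a \<in> carrier \<and> b \<in> carrier \<and> d \<in> carrier \<and> rel a b d" for a b c d
  proof -
    obtain p x u where "a = (p, x, u)" by (cases a)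
    moreover obtain q y v where "b = (q, y, v)" by (cases b)
    moreover obtain r z w where "c = (r, z, w)" by (cases c)
    moreover obtain s z' w' where "d = (s, z', w')" by (cases d)
    ultimately show ?thesis
      using that
      by (cases p; cases q; cases r; cases s; simp add: mixed_def)
        (metis add_left_cancel add_right_cancel)+
  qed
  show "\<exists>c. a \<in> carrier \<and> b \<in> carrier \<and> c \<in> carrier \<and> rel a b c"
    if "a \<in> carrier" "b \<in> carrier" for a b
  proof -
    obtain p x u q y v where ab: "a = (p, x, u)" "b = (q, y, v)"
      by (cases a; cases b)
    have xy: "x \<in> A" "y \<in> A" "u \<in> U" "v \<in> U"
      using that ab by (auto simp: carrier_def)
    \<comment> \<open>Two odd factors fix the second coordinate first, through \<open>g\<close>, and
      then the first one through \<open>\<tau>\<close>; with a single odd factor the order is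
      reversed.\<close>
    define c where "c = (if p then if q then (False, \<tau> (g x y - u - v) - x - y, g x y - u - v)
        else (True, \<tau> v - x - y, g (\<tau> v - x - y) x - u - v)
      else if q then (True, \<tau> u - x - y, g y (\<tau> u - x - y) - u - v)
      else (False, - x - y, - u - v))"
    have "c \<in> carrier"
      using xy by (auto simp: c_def carrier_def closed g_in \<tau>_in)
    moreover have "rel a b c"
      by (auto simp: ab c_def mixed_def)
    ultimately show ?thesis
      using that by blast
  qed
  show "a \<in> carrier \<and> b \<in> carrier \<and> c \<in> carrier"
    if "a \<in> carrier \<and> b \<in> carrier \<and> c \<in> carrier \<and> rel a b c" for a b c
    using that by blast
qed

end

section \<open>The octahedral trade\<close>

fun rot :: "'a \<times> 'a \<times> 'a \<Rightarrow> 'a \<times> 'a \<times> 'a" where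
  "rot (x, y, z) = (y, z, x)"

locale partial_ip_system =
  fixes Y :: "'a set" and j :: "'a \<Rightarrow> 'a" and P :: "('a \<times> 'a \<times> 'a) set"
  assumes j_in: "x \<in> Y \<Longrightarrow> j x \<in> Y" and j_j: "x \<in> Y \<Longrightarrow> j (j x) = x"
    and P_in: "(x, y, z) \<in> P \<Longrightarrow> x \<in> Y"
    and P_rot: "(x, y, z) \<in> P \<Longrightarrow> (y, z, x) \<in> P"
    and P_flip: "(x, y, z) \<in> P \<Longrightarrow> (j y, j x, j z) \<in> P"
    and P_unique: "(x, y, z) \<in> P \<Longrightarrow> (x, y, z') \<in> P \<Longrightarrow> z = z'"
    and P_nontrivial: "(x, y, z) \<in> P \<Longrightarrow> y \<noteq> j x"
begin

lemma P_rotations: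
  assumes "(x, y, z) \<in> P"
  shows "(y, z, x) \<in> P" "(z, x, y) \<in> P" "x \<in> Y" "y \<in> Y" "z \<in> Y"
  using P_rot[OF assms] P_rot[OF P_rot[OF assms]] P_in[OF assms] P_in[OF P_rot[OF assms]]
    P_in[OF P_rot[OF P_rot[OF assms]]]
  by simp_all

lemma P_Y: "(x, y, z) \<in> P \<Longrightarrow> x \<in> Y \<and> y \<in> Y \<and> z \<in> Y"
  using P_rotations by blast

lemma P_all:
  assumes "(x, y, z) \<in> P"
  shows "(x, y, z) \<in> P \<and> (y, z, x) \<in> P \<and> (z, x, y) \<in> P \<and> x \<in> Y \<and> y \<in> Y \<and> z \<in> Y"
  using assms P_rotations[OF assms] by simp

text \<open>The rotation of (z^-1, y^-1, x^-1) that starts with the inverted factors of xy, so that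
  v(x, y)^-1 = v(y^-1, x^-1).\<close>

fun flip :: "'a \<times> 'a \<times> 'a \<Rightarrow> 'a \<times> 'a \<times> 'a" where
  "flip (x, y, z) = (j y, j x, j z)"

end

text \<open>\<open>V (x, y, z)\<close> is v(x, y); indexing by the triple is harmless, since x and y
  determine z.\<close>

locale octahedral_trade = ip_system H e i T + partial_ip_system Y j P
  for H :: "'b set" and e i T and Y :: "'a set" and j P +
  fixes X :: "'a \<Rightarrow> 'b" and V :: "'a \<times> 'a \<times> 'a \<Rightarrow> 'b"
  assumes X_inj: "inj_on X Y" and V_inj: "inj_on V P"
    and X_V: "x \<in> Y \<Longrightarrow> t \<in> P \<Longrightarrow> X x \<noteq> V t"
    and X_e: "x \<in> Y \<Longrightarrow> X x \<noteq> e" and V_e: "t \<in> P \<Longrightarrow> V t \<noteq> e"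
    and X_j: "x \<in> Y \<Longrightarrow> X (j x) = i (X x)" and V_flip: "t \<in> P \<Longrightarrow> V (flip t) = i (V t)"
    and T_XXV: "(x, y, z) \<in> P \<Longrightarrow> T (X x) (X y) (V (x, y, z))"
    and T_VVV: "(x, y, z) \<in> P \<Longrightarrow> T (V (x, y, z)) (V (y, z, x)) (V (z, x, y))"
begin

text \<open>Three clauses are the rotations of a face with two \<open>X\<close> vertices. The last
  needs no rotated copies: rotating (x, y, z) rotates the face.\<close>

inductive W :: "'b \<Rightarrow> 'b \<Rightarrow> 'b \<Rightarrow> bool" where
  "(x, y, z) \<in> P \<Longrightarrow> W (X x) (X y) (V (x, y, z))"
| "(x, y, z) \<in> P \<Longrightarrow> W (X y) (V (x, y, z)) (X x)"
| "(x, y, z) \<in> P \<Longrightarrow> W (V (x, y, z)) (X x) (X y)"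
| "(x, y, z) \<in> P \<Longrightarrow> W (V (x, y, z)) (V (y, z, x)) (V (z, x, y))"

text \<open>In the octahedron \<open>X y\<close> is antipodal to \<open>V (z, x, y)\<close>, so the
  complementary faces join \<open>X y\<close> to the other two \<open>V\<close> vertices, or consist
  of the three \<open>X\<close> vertices.\<close>

inductive B :: "'b \<Rightarrow> 'b \<Rightarrow> 'b \<Rightarrow> bool" where
  "(x, y, z) \<in> P \<Longrightarrow> B (X y) (V (x, y, z)) (V (y, z, x))"
| "(x, y, z) \<in> P \<Longrightarrow> B (V (x, y, z)) (V (y, z, x)) (X y)"
| "(x, y, z) \<in> P \<Longrightarrow> B (V (y, z, x)) (X y) (V (x, y, z))"
| "(x, y, z) \<in> P \<Longrightarrow> B (X x) (X y) (X z)"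

lemma X_eq: "x \<in> Y \<Longrightarrow> y \<in> Y \<Longrightarrow> X x = X y \<longleftrightarrow> x = y"
  by (rule inj_on_eq_iff[OF X_inj])

lemma V_eq: "s \<in> P \<Longrightarrow> t \<in> P \<Longrightarrow> V s = V t \<longleftrightarrow> s = t"
  by (rule inj_on_eq_iff[OF V_inj])

lemma i_V: "(x, y, z) \<in> P \<Longrightarrow> i (V (x, y, z)) = V (j y, j x, j z)"
  using V_flip[of "(x, y, z)"] by simp

lemma i_X: "x \<in> Y \<Longrightarrow> i (X x) = X (j x)"
  using X_j by simp

sublocale traded: ip_system H e i "\<lambda>a b c. T a b c \<and> \<not> W a b c \<or> B a b c"
proof (rule trade)
  fix a b c
  show "T a b c" if "W a b c"
    using that
  proof cases
    case (2 x y z)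
    then show ?thesis using T_rot[OF T_XXV] by simp
  next
    case (3 x y z)
    then show ?thesis using T_rot[OF T_rot[OF T_XXV]] by simp
  qed (use T_XXV T_VVV in simp_all)
  show "W b c a" if "W a b c"
    using that
  proof cases
    case (4 x y z)
    then show ?thesis using W.intros(4)[OF P_rot[OF 4(4)]] by simp
  qed (use W.intros in simp_all)
  show "B b c a" if "B a b c"
    using that
  proof cases
    case (4 x y z)
    then show ?thesis using B.intros(4)[OF P_rot[OF 4(4)]] by simp
  qed (use B.intros in simp_all)
  show "\<not> W e b c"
  proof
    assume "W e b c"
    then show False
      by cases (drule P_all, use X_e V_e in blast)+
  qed
  show "a \<in> H" if "B a b c"
    using that
  proof cases
    case (1 x y z)
    then show ?thesis using T_in[OF T_XXV] by simp
  next
    case (2 x y z)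
    then show ?thesis using T_in[OF T_XXV] by simp
  next
    case (3 x y z)
    then show ?thesis using T_in[OF T_XXV[OF P_rot[OF 3(4)]]] by simp
  next
    case (4 x y z)
    then show ?thesis using T_in[OF T_XXV] by simp
  qed
  \<comment> \<open>Reversal exchanges the first and third clauses and preserves the other two, up
    to rotating the flipped triple.\<close>
  show "W (i c) (i b) (i a)" if "W a b c"
    using that
  proof cases
    case (1 x y z)
    then show ?thesis
      using W.intros(3)[OF P_flip[OF 1(4)]] P_rotations[OF 1(4)] by (simp add: i_X i_V)
  next
    case (2 x y z)
    then show ?thesis
      using W.intros(2)[OF P_flip[OF 2(4)]] P_rotations[OF 2(4)] by (simp add: i_X i_V)
  next
    case (3 x y z)
    then show ?thesis
      using W.intros(1)[OF P_flip[OF 3(4)]] P_rotations[OF 3(4)] by (simp add: i_X i_V)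
  next
    case (4 x y z)
    then show ?thesis
      using W.intros(4)[OF P_flip[OF P_rotations(2)[OF 4(4)]]] P_rotations[OF 4(4)]
      by (simp add: i_V)
  qed
  show "B (i c) (i b) (i a)" if "B a b c"
    using that
  proof cases
    case (1 x y z)
    note P = P_rotations[OF 1(4)]
    show ?thesis
      using B.intros(2)[OF P_flip[OF P(1)]] P unfolding 1 by (simp add: i_V i_X 1(4))
  next
    case (2 x y z)
    note P = P_rotations[OF 2(4)]
    show ?thesis
      using B.intros(1)[OF P_flip[OF P(1)]] P unfolding 2 by (simp add: i_V i_X 2(4))
  next
    case (3 x y z)
    note P = P_rotations[OF 3(4)]
    show ?thesis
      using B.intros(3)[OF P_flip[OF P(1)]] P unfolding 3 by (simp add: i_V i_X 3(4))
  next
    case (4 x y z)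
    note P = P_rotations[OF 4(4)]
    show ?thesis
      using B.intros(4)[OF P_flip[OF P(1)]] P unfolding 4 by (simp add: i_X)
  qed
  \<comment> \<open>The kinds of the first two entries, told apart by \<open>X_V\<close>, identify
    the clause. A \<open>V\<close> entry determines the triple; two \<open>X\<close> entries do so
    by \<open>P_unique\<close>.\<close>
  show "c = d" if "B a b c" "B a b d" for d
    using that
    by - (elim B.cases; drule P_all; drule P_all;
        auto simp: X_eq V_eq X_V X_V[symmetric] dest: P_unique)
  \<comment> \<open>Up to rotating the triple, both sides give the directed edges (x, y), (y, v(x,
    y)), (v(x, y), x) and (v(x, y), v(y, z)).\<close>
  show "(\<exists>c. W a b c) \<longleftrightarrow> (\<exists>c. B a b c)"
  proof
    assume "\<exists>c. W a b c"
    then obtain c where "W a b c" ..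
    then show "\<exists>c. B a b c"
    proof cases
      case (3 x y z)
      then show ?thesis using B.intros(3)[OF P_rotations(2)[OF 3(4)]] by auto
    qed (use B.intros in blast)+
  next
    assume "\<exists>c. B a b c"
    then obtain c where "B a b c" ..
    then show "\<exists>c. W a b c"
    proof cases
      case (3 x y z)
      then show ?thesis using W.intros(3)[OF P_rotations(1)[OF 3(4)]] by auto
    qed (use W.intros in blast)+
  qed
qed

lemma mul_X:
  assumes "(x, y, z) \<in> P"
  shows "traded.mul (X x) (X y) = X (j z)"
proof -
  have "traded.mul (X x) (X y) = i (X z)"
    by (rule traded.mul_eq) (simp add: B.intros(4)[OF assms])
  then show ?thesis
    using X_j[OF P_rotations(5)[OF assms]] by simp
qed

end

section \<open>Coordinates for a partial IP loop\<close>

definition extend :: "('k \<Rightarrow> 'l) \<Rightarrow> 'k set \<Rightarrow> ('k \<Rightarrow> 'v::zero) \<Rightarrow> 'l \<Rightarrow> 'v" where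
  "extend f S h k = (if k \<in> f ` S then h (inv_into S f k) else 0)"

lemma extend_eq: "inj_on f S \<Longrightarrow> s \<in> S \<Longrightarrow> extend f S h (f s) = h s"
  by (simp add: extend_def)

lemma extend_in: "h ` S \<subseteq> D \<Longrightarrow> 0 \<in> D \<Longrightarrow> extend f S h k \<in> D"
  by (auto simp: extend_def inv_into_into)

text \<open>By way of \<open>\<phi>\<close>, the involution \<open>N\<close> maps the image of
  \<open>S\<close> under \<open>f\<close> to itself, hence also its complement, where both sides
  vanish.\<close>

lemma extend_odd:
  fixes h :: "'k \<Rightarrow> 'v::group_add"
  assumes inj: "inj_on f S" and N: "\<And>k. N (N k) = k"
    and \<phi>: "\<And>s. s \<in> S \<Longrightarrow> \<phi> s \<in> S \<and> f (\<phi> s) = N (f s) \<and> h (\<phi> s) = - h s"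
  shows "extend f S h (N k) = - extend f S h k"
proof (cases "k \<in> f ` S")
  case True
  then obtain s where "s \<in> S" "k = f s"
    by blast
  then show ?thesis
    using \<phi> extend_eq[OF inj] by metis
next
  case False
  have "N k \<notin> f ` S"
  proof
    assume "N k \<in> f ` S"
    then obtain s where "s \<in> S" "N k = f s"
      by blast
    then have "k = f (\<phi> s)" "\<phi> s \<in> S"
      using \<phi> N by metis+
    then show False
      using False by blast
  qed
  then show ?thesis
    using False by (simp add: extend_def)
qed

definition supported :: "'k set \<Rightarrow> ('k \<Rightarrow> 'v::zero) set" where
  "supported S = {f. \<forall>k. k \<notin> S \<longrightarrow> f k = 0}"

lemma subgroup_supported: "subgroup (supported S :: ('k \<Rightarrow> 'v::ab_group_add) set)"
  by (auto simp: subgroup_def supported_def)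

lemma finite_supported: "finite S \<Longrightarrow> finite (supported S :: ('k \<Rightarrow> 'v::{zero, finite}) set)"
  using finite_set_of_finite_funs[of S "UNIV :: 'v set" 0] by (simp add: supported_def)

section \<open>Odd, pairwise distinct vectors for elements and triples\<close>

context partial_ip_system
begin

text \<open>Modulo 4, 2 is its own negative but not 0, which gives self-inverse elements an odd
  nonzero vector. The coefficient at x is 1 or 2 in \<open>\<alpha> x\<close>, but 0 or -1 in the
  vector of any other element of \<open>Y\<close>.\<close>

definition \<alpha> :: "'a \<Rightarrow> 'a \<Rightarrow> 4" where
  "\<alpha> x = (\<lambda>s. if x = j x then 2 * of_bool (s = x) else of_bool (s = x) - of_bool (s = j x))"

lemma \<alpha>_odd: "x \<in> Y \<Longrightarrow> \<alpha> (j x) = - \<alpha> x"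
  by (auto simp: \<alpha>_def j_j)

lemma \<alpha>_supported: "x \<in> Y \<Longrightarrow> \<alpha> x \<in> supported Y"
  by (auto simp: \<alpha>_def supported_def j_in)

lemma \<alpha>_inj: "inj_on \<alpha> Y"
proof
  fix x y
  assume "x \<in> Y" "y \<in> Y" "\<alpha> x = \<alpha> y"
  then have "\<alpha> x x = \<alpha> y x"
    by simp
  then show "x = y"
    using j_j[OF \<open>y \<in> Y\<close>]
    by (cases "x = y"; cases "x = j y") (auto simp: \<alpha>_def split: if_splits)
qed

text \<open>
  The values \<open>\<epsilon> t\<close> must be distinct and nonzero, odd under \<open>flip\<close>, and sum to 0 over the rotations
  of \<open>t\<close>. The sum telescopes, except for \<open>t = (x, x, x)\<close>, where it is three times a unit vector: this is
  why coefficients modulo 3 are used.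
\<close>

definition \<eta> :: "'a \<times> 'a \<times> 'a \<Rightarrow> 'a \<times> 'a \<times> 'a \<Rightarrow> 3" where
  "\<eta> t = (\<lambda>s. of_bool (s = t) - (if rot t = t then 0 else of_bool (s = rot t)))"

definition \<epsilon> :: "'a \<times> 'a \<times> 'a \<Rightarrow> 'a \<times> 'a \<times> 'a \<Rightarrow> 3" where
  "\<epsilon> t = \<eta> t - \<eta> (flip t)"

lemma flip_in: "t \<in> P \<Longrightarrow> flip t \<in> P"
  using P_flip by (cases t) (simp only: flip.simps)

lemma flip_flip: "t \<in> P \<Longrightarrow> flip (flip t) = t"
  by (cases t) (auto simp: j_j dest: P_Y)

lemma rot_in: "t \<in> P \<Longrightarrow> rot t \<in> P"
  using P_rot by (cases t) (simp only: rot.simps)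

lemma \<epsilon>_odd: "t \<in> P \<Longrightarrow> \<epsilon> (flip t) = - \<epsilon> t"
  by (simp add: \<epsilon>_def flip_flip)

lemma \<eta>_outside:
  assumes "t \<in> P" "s \<notin> P"
  shows "\<eta> t s = 0"
proof -
  have "s \<noteq> t" "s \<noteq> rot t"
    using assms rot_in by blast+
  then show ?thesis
    by (simp add: \<eta>_def)
qed

lemma \<epsilon>_supported:
  assumes "t \<in> P"
  shows "\<epsilon> t \<in> supported P"
proof -
  have "\<epsilon> t s = 0" if "s \<notin> P" for s
    using \<eta>_outside[OF assms that] \<eta>_outside[OF flip_in[OF assms] that] by (simp add: \<epsilon>_def)
  then show ?thesis
    unfolding supported_def by blast
qed

lemma rot_rot_rot: "rot (rot (rot t)) = t"
  by (cases t) simp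

lemma \<eta>_sum: "\<eta> t + \<eta> (rot t) + \<eta> (rot (rot t)) = 0"
proof
  fix s
  show "(\<eta> t + \<eta> (rot t) + \<eta> (rot (rot t))) s = 0 s"
  proof (cases "rot t = t")
    case True
    then show ?thesis
      by (simp add: \<eta>_def)
  next
    case False
    then have "rot (rot t) \<noteq> rot t" "t \<noteq> rot (rot t)"
      using rot_rot_rot by metis+
    then show ?thesis
      using False by (simp add: \<eta>_def rot_rot_rot)
  qed
qed

lemma \<epsilon>_sum: "\<epsilon> (x, y, z) + \<epsilon> (y, z, x) + \<epsilon> (z, x, y) = 0"
proof -
  have rearrange: "(a - a') + (b - b') + (c - c') = (a + b + c) - (a' + c' + b')"
    for a b c a' b' c' :: "'a \<times> 'a \<times> 'a \<Rightarrow> 3"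
    by (rule ext) simp
  show ?thesis
    unfolding \<epsilon>_def rearrange
    using \<eta>_sum[of "(x, y, z)"] \<eta>_sum[of "(j y, j x, j z)"]
    by (simp only: rot.simps flip.simps diff_self)
qed

text \<open>An equality would make two cyclically adjacent entries inverse to each other, against
  \<open>P_nontrivial\<close>. Hence the supports of \<open>\<eta> t\<close> and
  \<open>\<eta> (flip t)\<close> are disjoint.\<close>

lemma flip_rotations:
  assumes "t \<in> P"
  shows "flip t \<noteq> t" "flip t \<noteq> rot t" "flip t \<noteq> rot (rot t)"
proof -
  obtain x y z where t: "t = (x, y, z)"
    by (cases t)
  then have P: "(x, y, z) \<in> P"
    using assms by simp
  have "y \<noteq> j x" "z \<noteq> j y" "x \<noteq> j z"
    using P_nontrivial[OF P] P_nontrivial[OF P_rotations(1)[OF P]]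
      P_nontrivial[OF P_rotations(2)[OF P]] by simp_all
  then show "flip t \<noteq> t" "flip t \<noteq> rot t" "flip t \<noteq> rot (rot t)"
    unfolding t by auto
qed

lemma rot_flip: "rot (flip (rot t)) = flip t"
  by (cases t) simp

lemma rot_flip_fixed: "t \<in> P \<Longrightarrow> rot (flip t) = flip t \<longleftrightarrow> rot t = t"
  using flip_flip[of t] flip_flip[of "rot t"] rot_in[of t] rot_flip[of t] rot_rot_rot by metis

lemma \<epsilon>_self:
  assumes "t \<in> P"
  shows "\<epsilon> t t = 1"
proof -
  have "t \<noteq> flip t" "t \<noteq> rot (flip t)"
    using flip_rotations[OF assms] rot_rot_rot by metis+
  then show ?thesis
    by (simp add: \<epsilon>_def \<eta>_def)
qed

lemma \<epsilon>_inj: "inj_on \<epsilon> P"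
proof (rule inj_onI, rule ccontr)
  fix t s
  assume P: "t \<in> P" "s \<in> P" and eq: "\<epsilon> t = \<epsilon> s" and "t \<noteq> s"
  \<comment> \<open>\<open>\<epsilon> s\<close> takes the value 1 only at s and, unless s is fixed
    by \<open>rot\<close>, at \<open>rot (flip s)\<close>; and \<open>\<epsilon> t\<close> is 1 at
    t.\<close>
  then have s: "rot s \<noteq> s" and t: "t = rot (flip s)"
    using \<epsilon>_self[OF P(1)] rot_flip_fixed[OF P(2)] flip_rotations[OF P(2)] unfolding eq
    by (auto simp: \<epsilon>_def \<eta>_def of_bool_def split: if_splits)
  have "rot t \<noteq> t" "rot t \<noteq> flip t" "rot t \<noteq> rot (flip t)"
    using flip_rotations[OF P(1)] rot_rot_rot rot_flip_fixed[OF P(2)] s t by metis+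
  then have "\<epsilon> t (rot t) = - 1"
    by (simp add: \<epsilon>_def \<eta>_def)
  moreover have rot_t: "rot t = flip (rot s)"
    using t rot_flip[of s] rot_rot_rot by metis
  \<comment> \<open>\<open>rot t\<close> is the third member of the rotation class of
    \<open>flip s\<close>, so it misses all four support points of
    \<open>\<epsilon> s\<close>.\<close>
  have "rot t \<noteq> s" "rot t \<noteq> rot s" "rot t \<noteq> flip s" "rot t \<noteq> rot (flip s)"
    using flip_rotations[OF rot_in[OF P(2)]] rot_rot_rot s t \<open>rot t \<noteq> t\<close> rot_t
      flip_flip[OF P(2)] flip_flip[OF rot_in[OF P(2)]] by metis+
  then have "\<epsilon> s (rot t) = 0"
    by (simp add: \<epsilon>_def \<eta>_def)
  ultimately show False
    using eq by simp
qed

end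

section \<open>The base loop of a partial IP loop and its trade\<close>

context partial_ip_system
begin

fun key :: "'a \<times> 'a \<times> 'a \<Rightarrow> ('a \<Rightarrow> 4) \<times> ('a \<Rightarrow> 4)" where
  "key (x, y, z) = (\<alpha> x, \<alpha> y)"

fun \<sigma> :: "'a \<times> 'a \<times> 'a \<Rightarrow> 'a \<Rightarrow> 4" where
  "\<sigma> (x, y, z) = \<alpha> x + \<alpha> y"

lemma \<alpha>_eq: "x \<in> Y \<Longrightarrow> y \<in> Y \<Longrightarrow> \<alpha> x = \<alpha> y \<longleftrightarrow> x = y"
  by (rule inj_on_eq_iff[OF \<alpha>_inj])

lemma key_inj: "inj_on key P"
proof
  fix s t
  assume P: "s \<in> P" "t \<in> P" and eq: "key s = key t"
  obtain x y z x' y' z' where st: "s = (x, y, z)" "t = (x', y', z')"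
    by (cases s; cases t)
  then have "x = x'" "y = y'"
    using P_Y P eq \<alpha>_eq by auto
  then show "s = t"
    using P_unique P st by blast
qed

text \<open>\<open>g\<close> and \<open>\<tau>\<close> are prescribed exactly where
  \<open>mixed\<close> needs them to relate the odd elements with coordinates
  (\<open>\<alpha> x\<close>, 0) and (\<open>\<alpha> y\<close>, 0) to the even one with (0,
  \<open>\<epsilon> (x, y, z)\<close>); elsewhere they are 0.\<close>

definition g :: "('a \<Rightarrow> 4) \<Rightarrow> ('a \<Rightarrow> 4) \<Rightarrow> 'a \<times> 'a \<times> 'a \<Rightarrow> 3" where
  "g a b = extend key P \<epsilon> (a, b)"

definition \<tau> :: "('a \<times> 'a \<times> 'a \<Rightarrow> 3) \<Rightarrow> 'a \<Rightarrow> 4" where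
  "\<tau> = extend \<epsilon> P \<sigma>"

lemma \<epsilon>_nonzero: "t \<in> P \<Longrightarrow> \<epsilon> t \<noteq> 0"
  using \<epsilon>_self by fastforce

sublocale base: two_part_system "supported Y" "supported P" g \<tau>
proof
  show "subgroup (supported Y :: ('a \<Rightarrow> 4) set)"
    "subgroup (supported P :: ('a \<times> 'a \<times> 'a \<Rightarrow> 3) set)"
    by (rule subgroup_supported)+
  note zero = this[THEN subgroup_closed(1)] this[THEN subgroup_closed(4)]
  show "g a b \<in> supported P" for a b
    unfolding g_def by (rule extend_in) (use \<epsilon>_supported in \<open>auto simp: supported_def\<close>)
  show "\<tau> u \<in> supported Y" for u
    unfolding \<tau>_def
  proof (rule extend_in)
    show "\<sigma> ` P \<subseteq> supported Y"
    proof
      fix a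
      assume "a \<in> \<sigma> ` P"
      then obtain x y z where "(x, y, z) \<in> P" "a = \<alpha> x + \<alpha> y"
        by auto
      then show "a \<in> supported Y"
        using P_Y zero(3)[OF \<alpha>_supported \<alpha>_supported] by blast
    qed
  qed (rule zero(1))
  show "g (- b) (- a) = - g a b" for a b
  proof -
    have "extend key P \<epsilon> ((\<lambda>(a, b). (- b, - a)) (a, b)) = - extend key P \<epsilon> (a, b)"
    proof (rule extend_odd[OF key_inj, where \<phi> = flip])
      fix t
      assume t: "t \<in> P"
      have "key (flip t) = (\<lambda>(a, b). (- b, - a)) (key t)"
        using t by (cases t) (auto simp: \<alpha>_odd dest: P_Y)
      then show "flip t \<in> P \<and> key (flip t) = (\<lambda>(a, b). (- b, - a)) (key t) \<and> \<epsilon> (flip t) = - \<epsilon> t"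
        using flip_in[OF t] \<epsilon>_odd[OF t] by blast
    qed auto
    then show ?thesis
      by (simp add: g_def)
  qed
  \<comment> \<open>\<open>(a, - a)\<close> could be a key only if y = x^-1, so the default value 0
    applies.\<close>
  show "g a (- a) = 0" for a
  proof -
    have "(a, - a) \<notin> key ` P"
    proof
      assume "(a, - a) \<in> key ` P"
      then obtain x y z where t: "(x, y, z) \<in> P" "\<alpha> y = - \<alpha> x"
        by auto
      then have "y = j x"
        using P_Y[OF t(1)] \<alpha>_odd[of x] \<alpha>_eq[of y "j x"] j_in[of x] by simp
      then show False
        using P_nontrivial[OF t(1)] by simp
    qed
    then show ?thesis
      by (simp add: g_def extend_def)
  qed
  show "\<tau> (- u) = - \<tau> u" for u
    unfolding \<tau>_def
  proof (rule extend_odd[OF \<epsilon>_inj, where \<phi> = flip])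
    fix t
    assume t: "t \<in> P"
    have "\<sigma> (flip t) = - \<sigma> t"
      using t by (cases t) (auto simp: \<alpha>_odd dest: P_Y)
    then show "flip t \<in> P \<and> \<epsilon> (flip t) = - \<epsilon> t \<and> \<sigma> (flip t) = - \<sigma> t"
      using flip_in[OF t] \<epsilon>_odd[OF t] by blast
  qed simp
  show "\<tau> 0 = 0"
    using \<epsilon>_nonzero by (auto simp: \<tau>_def extend_def)
qed

lemma g_\<alpha>: "(x, y, z) \<in> P \<Longrightarrow> g (\<alpha> x) (\<alpha> y) = \<epsilon> (x, y, z)"
  using extend_eq[OF key_inj, of "(x, y, z)" \<epsilon>] by (simp add: g_def)

lemma \<tau>_\<epsilon>: "(x, y, z) \<in> P \<Longrightarrow> \<tau> (\<epsilon> (x, y, z)) = \<alpha> x + \<alpha> y"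
  using extend_eq[OF \<epsilon>_inj, of "(x, y, z)" \<sigma>] by (simp add: \<tau>_def)

lemma X_in: "x \<in> Y \<Longrightarrow> (True, \<alpha> x, 0) \<in> base.carrier"
  by (simp add: base.carrier_def \<alpha>_supported subgroup_closed(1)[OF subgroup_supported])

lemma V_in: "t \<in> P \<Longrightarrow> (False, 0, \<epsilon> t) \<in> base.carrier"
  by (simp add: base.carrier_def \<epsilon>_supported subgroup_closed(1)[OF subgroup_supported])

text \<open>Parity separates the \<open>X\<close> from the \<open>V\<close> elements. Even elements
  multiply as in an abelian group, which reduces \<open>T_VVV\<close> to
  \<open>\<epsilon>_sum\<close>.\<close>

sublocale octahedral_trade base.carrier "(False, 0, 0)" base.inv
  "\<lambda>a b c. a \<in> base.carrier \<and> b \<in> base.carrier \<and> c \<in> base.carrier \<and> base.rel a b c" Y j P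
  "\<lambda>x. (True, \<alpha> x, 0)" "\<lambda>t. (False, 0, \<epsilon> t)"
proof
  show "inj_on (\<lambda>x. (True, \<alpha> x, 0 :: 'a \<times> 'a \<times> 'a \<Rightarrow> 3)) Y"
    using \<alpha>_inj by (auto simp: inj_on_def)
  show "inj_on (\<lambda>t. (False, 0 :: 'a \<Rightarrow> 4, \<epsilon> t)) P"
    using \<epsilon>_inj by (auto simp: inj_on_def)
  fix x y z
  assume P: "(x, y, z) \<in> P"
  have mixed: "base.mixed (\<alpha> x) 0 (\<alpha> y) 0 0 (\<epsilon> (x, y, z))"
    using P by (simp add: base.mixed_def g_\<alpha> \<tau>_\<epsilon>)
  show "(True, \<alpha> x, 0) \<in> base.carrier \<and> (True, \<alpha> y, 0) \<in> base.carrier \<and>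
      (False, 0, \<epsilon> (x, y, z)) \<in> base.carrier \<and>
      base.rel (True, \<alpha> x, 0) (True, \<alpha> y, 0) (False, 0, \<epsilon> (x, y, z))"
    using P P_rotations[OF P] X_in V_in mixed by simp
  show "(False, 0, \<epsilon> (x, y, z)) \<in> base.carrier \<and> (False, 0, \<epsilon> (y, z, x)) \<in> base.carrier \<and>
      (False, 0, \<epsilon> (z, x, y)) \<in> base.carrier \<and>
      base.rel (False, 0, \<epsilon> (x, y, z)) (False, 0, \<epsilon> (y, z, x)) (False, 0, \<epsilon> (z, x, y))"
    using P P_rotations[OF P] V_in \<epsilon>_sum by simp
qed (auto simp: \<alpha>_odd \<epsilon>_odd \<epsilon>_nonzero)

lemma finite_carrier:
  assumes "finite Y"
  shows "finite base.carrier"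
proof -
  have "P \<subseteq> Y \<times> Y \<times> Y"
    using P_Y by auto
  then have "finite P"
    by (rule finite_subset) (intro finite_cartesian_product assms)
  then show ?thesis
    unfolding base.carrier_def by (intro finite_cartesian_product finite_supported assms) simp
qed

lemma mul_inverse:
  assumes "x \<in> Y"
  shows "traded.mul (True, \<alpha> x, 0) (True, \<alpha> (j x), 0) = (False, 0, 0)"
  using traded.mul_i_right[OF X_in[OF assms]] by (simp add: \<alpha>_odd[OF assms])

end

section \<open>Transport into the original type\<close>

lemma ip_loop_transport:
  assumes "ip_loop H m" and inj: "inj_on \<phi> H"
  shows "ip_loop (\<phi> ` H) (\<lambda>a b. \<phi> (m (inv_into H \<phi> a) (inv_into H \<phi> b)))"
  using assms(1)
proof (rule ip_loopE)
  fix e i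
  assume H: "e \<in> H" "\<And>a. a \<in> H \<Longrightarrow> i a \<in> H"
    "\<And>a b. a \<in> H \<Longrightarrow> b \<in> H \<Longrightarrow> m a b \<in> H"
    "\<And>a. a \<in> H \<Longrightarrow> m e a = a" "\<And>a. a \<in> H \<Longrightarrow> m a e = a"
    "\<And>a. a \<in> H \<Longrightarrow> m a (i a) = e" "\<And>a. a \<in> H \<Longrightarrow> m (i a) a = e"
    "\<And>a b. a \<in> H \<Longrightarrow> b \<in> H \<Longrightarrow> m (i a) (m a b) = b"
    "\<And>a b. a \<in> H \<Longrightarrow> b \<in> H \<Longrightarrow> m (m b a) (i a) = b"
  show ?thesis
    by (rule ip_loopI[of "\<phi> e" _ "\<lambda>a. \<phi> (i (inv_into H \<phi> a))"])
      (auto simp: H inv_into_f_f[OF inj])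
qed

text \<open>Elements of \<open>H\<close> outside the image of \<open>X\<close> receive fresh names
  outside \<open>X\<close>; an infinite type has enough of them.\<close>

lemma extend_inverse_to_infinite:
  fixes f :: "'a \<Rightarrow> 'b"
  assumes "infinite (UNIV :: 'a set)" "finite X" "finite H" "inj_on f X" "f ` X \<subseteq> H"
  obtains \<phi> :: "'b \<Rightarrow> 'a" where "inj_on \<phi> H" "\<And>x. x \<in> X \<Longrightarrow> \<phi> (f x) = x"
proof -
  obtain Z where Z: "finite Z" "card Z = card (H - f ` X)" "Z \<subseteq> UNIV - X"
    using infinite_arbitrarily_large[of "UNIV - X"] assms(1,2) by (metis Diff_infinite_finite)
  then obtain h where h: "bij_betw h (H - f ` X) Z"
    using finite_same_card_bij[of "H - f ` X" Z] assms(3) by auto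
  define \<phi> where "\<phi> a = (if a \<in> f ` X then inv_into X f a else h a)" for a
  have \<phi>_f: "\<phi> (f x) = x" if "x \<in> X" for x
    using that assms(4) by (simp add: \<phi>_def)
  have h_notin: "h a \<notin> X" if "a \<in> H - f ` X" for a
    using h Z that by (auto simp: bij_betw_def)
  have "inj_on \<phi> H"
  proof (rule inj_onI)
    fix a b
    assume ab: "a \<in> H" "b \<in> H" "\<phi> a = \<phi> b"
    have in_X: "\<phi> c \<in> X \<longleftrightarrow> c \<in> f ` X" if "c \<in> H" for c
      using that h_notin[of c] inv_into_into[of c f X] by (auto simp: \<phi>_def)
    show "a = b"
    proof (cases "a \<in> f ` X")
      case True
      then have "b \<in> f ` X"
        using ab in_X by metis
      then show ?thesis
        using True ab(3) inv_into_injective[of X f a b] by (simp add: \<phi>_def)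
    next
      case False
      then have "b \<notin> f ` X"
        using ab in_X by metis
      then show ?thesis
        using False ab inj_onD[OF bij_betw_imp_inj_on[OF h], of a b] by (simp add: \<phi>_def)
    qed
  qed
  then show thesis
    using that \<phi>_f by blast
qed

section \<open>Embedding a finite subset of an IP loop\<close>

theorem theorem1:
  fixes G :: "'a set" and m :: "'a \<Rightarrow> 'a \<Rightarrow> 'a" and X :: "'a set"
  assumes "ip_loop G m" and "finite X" and "X \<noteq> {}" and "X \<subseteq> G"
  shows "\<exists>H (m' :: 'a \<Rightarrow> 'a \<Rightarrow> 'a). finite H \<and> ip_loop H m' \<and> X \<subseteq> H \<and>
           (\<forall>x\<in>X. \<forall>y\<in>X. m x y \<in> X \<longrightarrow> m x y = m' x y)"
proof (cases "finite (UNIV :: 'a set)")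
  case True
  \<comment> \<open>A finite type may have no room for the new loop, but then \<open>G\<close>
    itself serves.\<close>
  then have "finite G"
    by (rule rev_finite_subset) simp
  then show ?thesis
    using assms by blast
next
  case False
  show ?thesis
    using assms(1)
  proof (rule ip_loopE)
    fix e i
    assume G: "e \<in> G" "\<And>a. a \<in> G \<Longrightarrow> i a \<in> G"
      "\<And>a b. a \<in> G \<Longrightarrow> b \<in> G \<Longrightarrow> m a b \<in> G"
      "\<And>a. a \<in> G \<Longrightarrow> m e a = a" "\<And>a. a \<in> G \<Longrightarrow> m a e = a"
      "\<And>a. a \<in> G \<Longrightarrow> m a (i a) = e" "\<And>a. a \<in> G \<Longrightarrow> m (i a) a = e"
      "\<And>a b. a \<in> G \<Longrightarrow> b \<in> G \<Longrightarrow> m (i a) (m a b) = b"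
      "\<And>a b. a \<in> G \<Longrightarrow> b \<in> G \<Longrightarrow> m (m b a) (i a) = b"
      "\<And>a. a \<in> G \<Longrightarrow> i (i a) = a"
    \<comment> \<open>Closure under inverses makes room for z = (xy)^-1; the identity is set apart
      and sent to the unit.\<close>
    define Y where "Y = X \<union> i ` X - {e}"
    define P where "P = {(x, y, z). x \<in> Y \<and> y \<in> Y \<and> z \<in> Y \<and> m x y = i z}"
    have YG: "x \<in> G" "x \<noteq> e" if "x \<in> Y" for x
      using that assms(4) G(2) by (auto simp: Y_def)
    have i_e: "i e = e"
      using G(6)[OF G(1)] G(4)[OF G(2)[OF G(1)]] by simp
    \<comment> \<open>Cancelling x gives y = x^-1 z^-1; right multiplication by z then gives yz =
      x^-1.\<close>
    have rot: "m y z = i x" if "m x y = i z" "x \<in> G" "y \<in> G" "z \<in> G" for x y z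
      using G(8)[OF that(2,3)] G(9)[OF G(2)[OF that(4)] G(2)[OF that(2)]] G(10)[OF that(4)] that(1)
      by simp
    have PD: "x \<in> Y \<and> y \<in> Y \<and> z \<in> Y \<and> x \<in> G \<and> y \<in> G \<and> z \<in> G \<and> z \<noteq> e \<and> m x y = i z"
      if "(x, y, z) \<in> P" for x y z
      using that YG by (simp add: P_def)
    have i_Y: "i x \<in> Y" if "x \<in> Y" for x
    proof -
      have "i x \<noteq> e"
        using YG[OF that] G(10)[of x] i_e by auto
      moreover have "i x \<in> X \<union> i ` X"
        using that assms(4) G(10) by (auto simp: Y_def)
      ultimately show ?thesis
        by (simp add: Y_def)
    qed
    interpret partial_ip_system Y i P
    proof
      show "i x \<in> Y" if "x \<in> Y" for x
        using that by (rule i_Y)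
      show "i (i x) = x" if "x \<in> Y" for x
        using YG(1)[OF that] by (rule G(10))
      fix x y z
      assume P: "(x, y, z) \<in> P"
      note p = PD[OF P]
      have yz: "m y z = i x"
        using p rot by blast
      show "x \<in> Y"
        using p by blast
      show "(y, z, x) \<in> P"
        using p yz by (simp add: P_def)
      show "(i y, i x, i z) \<in> P"
        using p yz G(8)[of y z] G(10)[of z] i_Y by (simp add: P_def)
      show "z = z'" if "(x, y, z') \<in> P" for z'
        using p PD[OF that] G(10)[of z] G(10)[of z'] by simp
      show "y \<noteq> i x"
        using p G(6)[of x] G(10)[of z] i_e by auto
    qed
    define h :: "'a \<Rightarrow> bool \<times> ('a \<Rightarrow> 4) \<times> ('a \<times> 'a \<times> 'a \<Rightarrow> 3)"
      where "h x = (if x = e then (False, 0, 0) else (True, \<alpha> x, 0))" for x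
    note H_unit = traded.mul_unit_left traded.mul_unit_right
    have X_cases: "x = e \<or> x \<in> Y" if "x \<in> X" for x
      using that by (auto simp: Y_def)
    have h_in: "h x \<in> base.carrier" if "x \<in> X" for x
      using X_cases[OF that] X_in traded.e_in by (auto simp: h_def)
    have h_inj: "inj_on h X"
    proof (rule inj_onI)
      fix x y
      assume "x \<in> X" "y \<in> X" "h x = h y"
      then show "x = y"
        using X_cases[of x] X_cases[of y] \<alpha>_eq[of x y] by (auto simp: h_def split: if_splits)
    qed
    have h_m: "h (m x y) = traded.mul (h x) (h y)" if xy: "x \<in> X" "y \<in> X" "m x y \<in> X" for x y
    proof -
      have xG: "x \<in> G" "y \<in> G"
        using xy assms(4) by blast+
      \<comment> \<open>Unit and inverse laws settle the first three cases; only the last relies on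
        the traded triples.\<close>
      consider "x = e" | "y = e" | "x \<noteq> e" "m x y = e" | "x \<noteq> e" "y \<noteq> e" "m x y \<noteq> e"
        by blast
      then show ?thesis
      proof cases
        case 1
        then show ?thesis
          using G(4)[OF xG(2)] H_unit(1)[OF h_in[OF xy(2)]] by (simp add: h_def)
      next
        case 2
        then show ?thesis
          using G(5)[OF xG(1)] H_unit(2)[OF h_in[OF xy(1)]] by (simp add: h_def)
      next
        case 3
        then have y: "y = i x"
          using G(8)[OF xG] G(5)[OF G(2)[OF xG(1)]] by simp
        have "x \<in> Y"
          using 3 X_cases[OF xy(1)] by blast
        then show ?thesis
          using mul_inverse[of x] YG(2)[OF j_in[of x]] 3 y by (simp add: h_def)
      next
        case 4
        then have Y: "x \<in> Y" "y \<in> Y" "m x y \<in> Y"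
          using X_cases xy by blast+
        then have "(x, y, i (m x y)) \<in> P"
          using j_in[OF Y(3)] j_j[OF Y(3)] by (simp add: P_def)
        then show ?thesis
          using mul_X[of x y "i (m x y)"] j_j[OF Y(3)] 4 by (simp add: h_def)
      qed
    qed
    have "finite Y"
      using assms(2) by (simp add: Y_def)
    note finite = finite_carrier[OF this]
    have "h ` X \<subseteq> base.carrier"
      using h_in by blast
    from extend_inverse_to_infinite[OF False assms(2) finite h_inj this]
    obtain \<phi> where \<phi>: "inj_on \<phi> base.carrier" "\<And>x. x \<in> X \<Longrightarrow> \<phi> (h x) = x"
      by blast
    have inv_\<phi>: "inv_into base.carrier \<phi> x = h x" if "x \<in> X" for x
      using inv_into_f_f[OF \<phi>(1) h_in[OF that]] \<phi>(2)[OF that] by simp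
    define m' where
      "m' a b = \<phi> (traded.mul (inv_into base.carrier \<phi> a) (inv_into base.carrier \<phi> b))" for a b
    have "X \<subseteq> \<phi> ` base.carrier"
    proof
      fix x
      assume "x \<in> X"
      then show "x \<in> \<phi> ` base.carrier"
        using \<phi>(2) h_in by (intro image_eqI[of _ _ "h x"]) simp_all
    qed
    moreover have "m x y = m' x y" if "x \<in> X" "y \<in> X" "m x y \<in> X" for x y
      unfolding m'_def inv_\<phi>[OF that(1)] inv_\<phi>[OF that(2)] h_m[OF that, symmetric]
      by (rule \<phi>(2)[OF that(3), symmetric])
    moreover have "ip_loop (\<phi> ` base.carrier) m'"
      unfolding m'_def by (rule ip_loop_transport[OF traded.ip_loop_mul \<phi>(1)])
    ultimately show ?thesis
      using finite by blast
  qed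
qed

end
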